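(* Let $K_n$ denote the complete graph on $n$ vertices. For any integers $n\ge 2$ and $t\ge 1$, $$\gamma_R(S(K_n,t))\le\begin{cases}\dfrac{2n^t+n-1}{n+1}, & t \text{ even},\\[3mm] \dfrac{2(n^t+1)}{n+1}, & t\text{ odd}.\end{cases}$$
   Context: Graphs are finite and simple. For a graph $G=(V,E)$ of order $n\ge 2$ and an integer $t\ge1$, let $V^t$ be the set of words of length $t$ over the alphabet $V$; concatenation of words is written by juxtaposition and $x^{k}$ denotes the word $xx\cdots x$ of length $k$. The (generalized) Sierpiński graph $S(G,t)$ is the graph with vertex set $V^t$ and edge set $\{\{w x y^{r-1}, w y x^{r-1}\}: \{x,y\}\in E,\ r\in\{1,\dots,t\},\ w\in V^{t-r}\}$ (so $S(G,1)=G$). A Roman dominating function on a graph $H$ with vertex set $W$ is a map $f:W\to\{0,1,2\}$ such that every vertex $v$ with $f(v)=0$ has a neighbor $u$ with $f(u)=2$. Its weight is $\sum_{u\in W}f(u)$. The Roman domination number $\gamma_R(H)$ is the minimum weight of a Roman dominating function on $H$. *)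

theory Defs
  imports Complex_Main
begin

type_synonym 'a ugraph = "'a set \<times> 'a set set"

abbreviation vertices :: "'a ugraph \<Rightarrow> 'a set" where
  "vertices G \<equiv> fst G"

abbreviation edges :: "'a ugraph \<Rightarrow> 'a set set" where
  "edges G \<equiv> snd G"

definition simple_graph :: "'a ugraph \<Rightarrow> bool" where
  "simple_graph G \<longleftrightarrow>
     finite (vertices G) \<and> (\<forall>e \<in> edges G. e \<subseteq> vertices G \<and> card e = 2)"

definition complete_graph :: "'a set \<Rightarrow> 'a ugraph" where
  "complete_graph V = (V, {{x, y} | x y. x \<in> V \<and> y \<in> V \<and> x \<noteq> y})"

definition words :: "'a set \<Rightarrow> nat \<Rightarrow> 'a list set" where
  "words V t = {w. set w \<subseteq> V \<and> length w = t}"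

definition sierpinski :: "'a ugraph \<Rightarrow> nat \<Rightarrow> 'a list ugraph" where
  "sierpinski G t =
     (words (vertices G) t,
      {{w @ [x] @ replicate (r - 1) y, w @ [y] @ replicate (r - 1) x} | w x y r.
         {x, y} \<in> edges G \<and> r \<in> {1..t} \<and> w \<in> words (vertices G) (t - r)})"

(* Only the values of f on the vertex set are constrained; its values elsewhere
   do not contribute to the weight. *)
definition roman_dominating :: "'a ugraph \<Rightarrow> ('a \<Rightarrow> nat) \<Rightarrow> bool" where
  "roman_dominating H f \<longleftrightarrow>
     (\<forall>v \<in> vertices H. f v \<in> {0, 1, 2}) \<and>
     (\<forall>v \<in> vertices H. f v = 0 \<longrightarrow>
        (\<exists>u \<in> vertices H. {u, v} \<in> edges H \<and> f u = 2))"

definition weight :: "'a ugraph \<Rightarrow> ('a \<Rightarrow> nat) \<Rightarrow> nat" where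
  "weight H f = (\<Sum>u \<in> vertices H. f u)"

definition roman_domination_number :: "'a ugraph \<Rightarrow> nat" where
  "roman_domination_number H = (LEAST k. \<exists>f. roman_dominating H f \<and> weight H f = k)"

lemma roman_domination_number_le:
  "roman_dominating H f \<Longrightarrow> roman_domination_number H \<le> weight H f"
  unfolding roman_domination_number_def by (rule Least_le) blast

lemma roman_domination_number_attained:
  "\<exists>f. roman_dominating H f \<and> weight H f = roman_domination_number H"
proof -
  have "roman_dominating H (\<lambda>_. 1)"
    by (simp add: roman_dominating_def)
  then have "\<exists>k f. roman_dominating H f \<and> weight H f = k" by blast
  then show ?thesis
    unfolding roman_domination_number_def by (rule LeastI_ex)
qed

lemma simple_graph_complete_graph: "finite V \<Longrightarrow> simple_graph (complete_graph V)"
  by (auto simp: simple_graph_def complete_graph_def)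

lemma simple_graph_sierpinski:
  assumes "simple_graph G"
  shows "simple_graph (sierpinski G t)"
proof -
  have V: "finite (words (vertices G) t)"
    using assms finite_lists_length_eq[of "vertices G" t]
    by (simp add: simple_graph_def words_def)
  have E: "e \<subseteq> words (vertices G) t \<and> card e = 2" if "e \<in> edges (sierpinski G t)" for e
  proof -
    obtain w x y r where e: "e = {w @ [x] @ replicate (r - 1) y, w @ [y] @ replicate (r - 1) x}"
      and xy: "{x, y} \<in> edges G" and r: "r \<in> {1..t}" and w: "w \<in> words (vertices G) (t - r)"
      using \<open>e \<in> _\<close> unfolding sierpinski_def snd_conv by blast
    have "x \<in> vertices G" "y \<in> vertices G" "card {x, y} = 2"
      using assms xy unfolding simple_graph_def by blast+
    then have "x \<noteq> y" by auto
    then show ?thesis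
      using \<open>x \<in> vertices G\<close> \<open>y \<in> vertices G\<close> r w
      by (simp add: e words_def set_replicate_conv_if)
  qed
  show ?thesis
    using V E by (simp add: simple_graph_def sierpinski_def)
qed

lemma sierpinski_1:
  assumes "simple_graph G"
  shows "sierpinski G 1 = ((\<lambda>x. [x]) ` vertices G, (\<lambda>e. (\<lambda>x. [x]) ` e) ` edges G)"
proof -
  have vert: "words (vertices G) 1 = (\<lambda>x. [x]) ` vertices G"
    by (auto simp: words_def length_Suc_conv)
  have "r \<in> {1..1} \<and> w \<in> words (vertices G) (1 - r) \<longleftrightarrow> r = 1 \<and> w = []" for r w
    by (cases "r = 1") (auto simp: words_def)
  then have edg: "edges (sierpinski G 1) = {{[x], [y]} | x y. {x, y} \<in> edges G}"
    unfolding sierpinski_def snd_conv by simp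
  have img: "{{[x], [y]} | x y. {x, y} \<in> edges G} = (\<lambda>e. (\<lambda>x. [x]) ` e) ` edges G"
  proof (intro set_eqI iffI)
    fix e assume "e \<in> (\<lambda>e. (\<lambda>x. [x]) ` e) ` edges G"
    then obtain d where d: "d \<in> edges G" "e = (\<lambda>x. [x]) ` d" by blast
    then obtain x y where "d = {x, y}"
      using assms by (meson card_2_iff simple_graph_def)
    then show "e \<in> {{[x], [y]} | x y. {x, y} \<in> edges G}"
      using d by auto
  next
    fix e assume "e \<in> {{[x], [y]} | x y. {x, y} \<in> edges G}"
    then obtain x y where xy: "{x, y} \<in> edges G" and e: "e = {[x], [y]}" by blast
    from e have "e = (\<lambda>x. [x]) ` {x, y}" by simp
    then show "e \<in> (\<lambda>e. (\<lambda>x. [x]) ` e) ` edges G" using xy by (rule image_eqI)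
  qed
  have "vertices (sierpinski G 1) = words (vertices G) 1"
    by (simp add: sierpinski_def)
  then show ?thesis
    unfolding prod_eq_iff fst_conv snd_conv using vert edg img by metis
qed

end

theory Submission
  imports Defs
begin

text \<open>
  An automaton reading words from left to right defines two families of codes:
  \<open>P\<^sub>t(a)\<close> (state \<open>Some a\<close>) and \<open>Q\<^sub>t\<close> (state \<open>None\<close>). The copy \<open>x S(K\<^sub>n, t)\<close> inside
  \<open>S(K\<^sub>n, t + 1)\<close> carries \<open>Q\<^sub>t\<close> or \<open>P\<^sub>t(a)\<close> in the first family, according to whether \<open>x = a\<close>,
  and \<open>P\<^sub>t(x)\<close> in the second. Then \<open>P\<^sub>t(a)\<close> dominates everything except, for even \<open>t\<close>, the extreme
  vertex \<open>a\<^sup>t\<close>, and \<open>Q\<^sub>t\<close> dominates everything except, for odd \<open>t\<close>, all extreme vertices; a vertex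
  left undominated inside a copy is dominated across the edge leaving that copy. The recursion also
  gives \<open>(n + 1) |P\<^sub>t(a)| = n\<^sup>t - (-1)\<^sup>t\<close>. Put weight 2 on \<open>P\<^sub>t(a)\<close>, and weight 1 on \<open>a\<^sup>t\<close>
  if \<open>t\<close> is even.
\<close>

text \<open>State \<open>Some a\<close> waits for the next \<open>a\<close>, state
  \<open>None\<close> has nothing pending. From \<open>None\<close>, the accepted words are the
  concatenations of blocks \<open>a u a\<close> with \<open>a\<close> not occurring in
  \<open>u\<close>.\<close>

fun code :: "'a option \<Rightarrow> 'a list \<Rightarrow> bool" where
  "code s [] \<longleftrightarrow> s = None"
| "code None (x # w) \<longleftrightarrow> code (Some x) w"
| "code (Some a) (x # w) \<longleftrightarrow> code (if x = a then None else Some a) w"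

text \<open>Each letter \<open>a\<close> toggles between \<open>None\<close> and
  \<open>Some a\<close>.\<close>

lemma code_replicate:
  "code None (replicate t a) \<longleftrightarrow> even t"
  "code (Some a) (replicate t a) \<longleftrightarrow> odd t"
  by (induction t) auto

lemma words_0: "words V 0 = {[]}"
  by (auto simp: words_def)

lemma words_Suc: "words V (Suc t) = (\<lambda>(x, w). x # w) ` (V \<times> words V t)"
  by (auto simp: words_def length_Suc_conv image_iff)

lemma Cons_in_words [simp]: "x # w \<in> words V (Suc t) \<longleftrightarrow> x \<in> V \<and> w \<in> words V t"
  by (auto simp: words_def)

lemma replicate_in_words: "a \<in> V \<Longrightarrow> replicate t a \<in> words V t"
  by (auto simp: words_def set_replicate_conv_if)

lemma finite_words: "finite V \<Longrightarrow> finite (words V t)"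
  using finite_lists_length_eq[of V t] by (simp add: words_def)

lemma sum_words_Suc: "(\<Sum>w\<in>words V (Suc t). f w) = (\<Sum>x\<in>V. \<Sum>w\<in>words V t. f (x # w))"
proof -
  have "(\<Sum>w\<in>words V (Suc t). f w) = (\<Sum>(x, w)\<in>V \<times> words V t. f (x # w))"
    unfolding words_Suc by (subst sum.reindex) (auto simp: inj_on_def case_prod_unfold)
  then show ?thesis by (simp add: sum.cartesian_product)
qed

lemma vertices_sierpinski_complete: "vertices (sierpinski (complete_graph V) t) = words V t"
  by (simp add: sierpinski_def complete_graph_def)

lemma sierpinski_edge_Cons:
  assumes "{u, v} \<in> edges (sierpinski G t)" "x \<in> vertices G"
  shows "{x # u, x # v} \<in> edges (sierpinski G (Suc t))"
proof -
  obtain w a b r where e: "{u, v} = {w @ [a] @ replicate (r - 1) b, w @ [b] @ replicate (r - 1) a}"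
    and ab: "{a, b} \<in> edges G" "r \<in> {1..t}" "w \<in> words (vertices G) (t - r)"
    using assms(1) unfolding sierpinski_def snd_conv by blast
  \<comment> \<open>Taking the image of the unordered pair avoids deciding which end is
    \<open>u\<close>.\<close>
  have "{x # u, x # v} = Cons x ` {u, v}" by simp
  also have "\<dots> = {(x # w) @ [a] @ replicate (r - 1) b, (x # w) @ [b] @ replicate (r - 1) a}"
    unfolding e by simp
  finally have "{x # u, x # v} = \<dots>" .
  moreover have "x # w \<in> words (vertices G) (Suc t - r)" "r \<in> {1..Suc t}"
    using ab assms(2) by (auto simp: words_def)
  ultimately show ?thesis
    using ab(1) unfolding sierpinski_def snd_conv by blast
qed

lemma sierpinski_edge_link:
  assumes "{x, y} \<in> edges G"
  shows "{x # replicate t y, y # replicate t x} \<in> edges (sierpinski G (Suc t))"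
proof -
  have "{x # replicate t y, y # replicate t x} =
      {[] @ [x] @ replicate (Suc t - 1) y, [] @ [y] @ replicate (Suc t - 1) x}"
    by simp
  moreover have "Suc t \<in> {1..Suc t}" "[] \<in> words (vertices G) (Suc t - Suc t)"
    by (auto simp: words_def)
  ultimately show ?thesis
    using assms unfolding sierpinski_def snd_conv by blast
qed

definition code_dominated :: "'a set \<Rightarrow> nat \<Rightarrow> 'a option \<Rightarrow> 'a list \<Rightarrow> bool" where
  "code_dominated V t s w \<longleftrightarrow> code s w \<or>
     (\<exists>u \<in> words V t. {u, w} \<in> edges (sierpinski (complete_graph V) t) \<and> code s u)"

text \<open>The last assumption says that reading \<open>x\<close> leads from \<open>s\<close> to
  \<open>s'\<close>, so domination within the copy \<open>x\<close> carries over.\<close>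

lemma code_dominated_Cons:
  assumes "code_dominated V t s' w" "x \<in> V" "\<And>u. code s (x # u) \<longleftrightarrow> code s' u"
  shows "code_dominated V (Suc t) s (x # w)"
  using assms(1) unfolding code_dominated_def
proof (elim disjE bexE conjE)
  fix u assume u: "u \<in> words V t" "{u, w} \<in> edges (sierpinski (complete_graph V) t)" "code s' u"
  have "x \<in> vertices (complete_graph V)"
    using assms(2) by (simp add: complete_graph_def)
  then have "{x # u, x # w} \<in> edges (sierpinski (complete_graph V) (Suc t))"
    using u(2) by (intro sierpinski_edge_Cons)
  moreover have "x # u \<in> words V (Suc t)" "code s (x # u)"
    using u assms(2,3) by auto
  ultimately show "code s (x # w) \<or> (\<exists>u \<in> words V (Suc t).
      {u, x # w} \<in> edges (sierpinski (complete_graph V) (Suc t)) \<and> code s u)"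
    by blast
qed (use assms(3) in simp)

text \<open>Domination across the edge between the copies \<open>x\<close> and
  \<open>y\<close>.\<close>

lemma code_dominated_link:
  assumes "x \<in> V" "y \<in> V" "x \<noteq> y" "code s (y # replicate t x)"
  shows "code_dominated V (Suc t) s (x # replicate t y)"
proof -
  have "{y, x} \<in> edges (complete_graph V)"
    using assms by (auto simp: complete_graph_def)
  from sierpinski_edge_link[OF this, of t] show ?thesis
    using assms replicate_in_words[of x V t] unfolding code_dominated_def by auto
qed

text \<open>The two claims need each other: reading a letter can switch the state, so they are
  proved by one induction.\<close>

lemma code_dominated_words:
  assumes "w \<in> words V t"
  shows "a \<in> V \<Longrightarrow> code_dominated V t (Some a) w \<or> even t \<and> w = replicate t a"
    and "code_dominated V t None w \<or> odd t \<and> (\<exists>b \<in> V. w = replicate t b)"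
  using assms
proof (induction t arbitrary: w a)
  case 0
  { case 1 then show ?case by (simp add: words_0) }
  { case 2 then show ?case by (simp add: words_0 code_dominated_def) }
next
  case (Suc t)
  {
    case 1
    then obtain x v where w: "w = x # v" and x: "x \<in> V" and v: "v \<in> words V t"
      by (auto simp: words_Suc)
    show ?case
    proof (cases "x = a")
      case True
      consider "code_dominated V t None v" | b where "odd t" "b \<in> V" "v = replicate t b"
        using Suc.IH(2)[OF v] by blast
      then show ?thesis
      proof cases
        case 1
        then show ?thesis
          using code_dominated_Cons[of V t None v x "Some a"] x True w by simp
      next
        case (2 b)
        \<comment> \<open>For \<open>b = a\<close> this is the permitted exception,
          \<open>Suc t\<close> being even. Otherwise \<open>b # replicate t a\<close> is a codeword,
          since \<open>b\<close> leaves the state at \<open>Some a\<close> and \<open>t\<close> is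
          odd.\<close>
        then show ?thesis
          using code_dominated_link[of x V b "Some a" t] x True w
          by (cases "b = a") (auto simp: code_replicate)
      qed
    next
      case False
      consider "code_dominated V t (Some a) v" | "even t" "v = replicate t a"
        using Suc.IH(1)[OF \<open>a \<in> V\<close> v] by blast
      then show ?thesis
      proof cases
        case 1
        then show ?thesis
          using code_dominated_Cons[of V t "Some a" v x "Some a"] x False w by simp
      next
        case 2
        \<comment> \<open>The neighbour \<open>a # replicate t x\<close> is a codeword:
          \<open>a\<close> leads to \<open>None\<close>, and \<open>t\<close> is even.\<close>
        then show ?thesis
          using code_dominated_link[of x V a "Some a" t] x \<open>a \<in> V\<close> False w
          by (simp add: code_replicate)
      qed
    qed
  }
  {
    case 2
    then obtain x v where w: "w = x # v" and x: "x \<in> V" and v: "v \<in> words V t"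
      by (auto simp: words_Suc)
    \<comment> \<open>The exception for \<open>v\<close> is \<open>replicate t x\<close>, which
      makes \<open>w\<close> constant of odd length.\<close>
    from Suc.IH(1)[OF x v] show ?case
      using code_dominated_Cons[of V t "Some x" v x None] x w by fastforce
  }
qed

text \<open>With p, q the sizes for \<open>Some a\<close> and \<open>None\<close>, the first letter
  gives p' = q + (n - 1) p and q' = n p. The factor n + 1 clears denominators.\<close>

lemma code_size:
  assumes "finite V"
  shows "a \<in> V \<Longrightarrow> (real (card V) + 1) * (\<Sum>w\<in>words V t. of_bool (code (Some a) w))
           = real (card V) ^ t - (-1) ^ t"
    and "(real (card V) + 1) * (\<Sum>w\<in>words V t. of_bool (code None w))
           = real (card V) ^ t + (-1) ^ t * real (card V)"
proof (induction t arbitrary: a)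
  case 0
  { case 1 then show ?case by (simp add: words_0) }
  { case 2 then show ?case by (simp add: words_0) }
next
  case (Suc t)
  let ?n = "real (card V)"
  let ?S = "\<lambda>s. \<Sum>w\<in>words V t. (of_bool (code s w) :: real)"
  {
    case 1
    have "(\<Sum>w\<in>words V (Suc t). of_bool (code (Some a) w)) =
        (\<Sum>x\<in>V. ?S (if x = a then None else Some a))"
      by (simp add: sum_words_Suc)
    also have "\<dots> = ?S None + (\<Sum>x\<in>V - {a}. ?S (Some a))"
      using assms 1 by (subst sum.remove[of V a]) auto
    also have "\<dots> = ?S None + (?n - 1) * ?S (Some a)"
    proof -
      have "card V \<ge> 1"
        using assms 1 by (metis One_nat_def Suc_leI card_gt_0_iff empty_iff)
      then have "real (card (V - {a})) = ?n - 1"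
        using assms 1 by (simp add: of_nat_diff)
      then show ?thesis by (simp only: sum_constant)
    qed
    finally have sum_Suc: "(\<Sum>w\<in>words V (Suc t). of_bool (code (Some a) w)) =
        ?S None + (?n - 1) * ?S (Some a)" .
    have "(?n + 1) * (\<Sum>w\<in>words V (Suc t). of_bool (code (Some a) w)) =
        (?n + 1) * ?S None + (?n - 1) * ((?n + 1) * ?S (Some a))"
      unfolding sum_Suc by (simp add: algebra_simps)
    then show ?case
      unfolding Suc.IH(2) Suc.IH(1)[OF 1] by (simp add: algebra_simps)
  }
  {
    case 2
    have "(?n + 1) * (\<Sum>w\<in>words V (Suc t). of_bool (code None w)) =
        (\<Sum>x\<in>V. (?n + 1) * ?S (Some x))"
      by (simp add: sum_words_Suc sum_distrib_left)
    also have "\<dots> = (\<Sum>x\<in>V. ?n ^ t - (-1) ^ t)"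
      using Suc.IH(1) by (intro sum.cong) auto
    finally show ?case by (simp add: algebra_simps)
  }
qed

theorem theorem15:
  fixes V :: "'a set" and n t :: nat
  assumes "n \<ge> 2" and "t \<ge> 1" and "card V = n"
  shows "real (roman_domination_number (sierpinski (complete_graph V) t))
         \<le> (if even t then (2 * real n ^ t + real n - 1) / (real n + 1)
             else 2 * (real n ^ t + 1) / (real n + 1))"
proof -
  let ?H = "sierpinski (complete_graph V) t"
  have fin: "finite V" and "V \<noteq> {}"
    using assms(1,3) by (auto intro: card_ge_0_finite)
  then obtain a where a: "a \<in> V" by blast
  define f :: "'a list \<Rightarrow> nat" where
    "f w = 2 * of_bool (code (Some a) w) + of_bool (even t \<and> w = replicate t a)" for w
  \<comment> \<open>The two summands of \<open>f\<close> are never both nonzero, so \<open>f\<close>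
    stays at most 2 and equals 2 on every codeword.\<close>
  have exc: "\<not> code (Some a) w" if "even t \<and> w = replicate t a" for w
    using that by (simp add: code_replicate)
  have "roman_dominating ?H f"
    unfolding roman_dominating_def vertices_sierpinski_complete
  proof (intro conjI ballI impI)
    fix w
    show "f w \<in> {0, 1, 2}"
      using exc[of w] by (auto simp: f_def)
  next
    fix w assume w: "w \<in> words V t" and "f w = 0"
    then have "\<not> code (Some a) w" "\<not> (even t \<and> w = replicate t a)"
      by (auto simp: f_def split: if_splits)
    then obtain u where "u \<in> words V t" "{u, w} \<in> edges ?H" "code (Some a) u"
      using code_dominated_words(1)[OF w a] by (auto simp: code_dominated_def)
    moreover from this have "f u = 2"
      using exc[of u] by (auto simp: f_def)
    ultimately show "\<exists>u \<in> words V t. {u, w} \<in> edges ?H \<and> f u = 2" by blast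
  qed
  then have "real (roman_domination_number ?H) \<le> real (weight ?H f)"
    by (intro of_nat_mono roman_domination_number_le)
  also have "real (weight ?H f) =
      2 * (\<Sum>w\<in>words V t. of_bool (code (Some a) w)) + of_bool (even t)"
  proof -
    have "(\<Sum>w\<in>words V t. of_bool (even t \<and> w = replicate t a)) = (of_bool (even t) :: real)"
      using sum.delta[OF finite_words[OF fin, of t], of "replicate t a" "\<lambda>_. 1 :: real"]
        replicate_in_words[OF a, of t] by (cases "even t") (auto simp: of_bool_def)
    then show ?thesis
      by (simp add: weight_def vertices_sierpinski_complete f_def sum.distrib sum_distrib_left)
  qed
  also have "\<dots> = 2 * ((real n ^ t - (-1) ^ t) / (real n + 1)) + of_bool (even t)"
  proof -
    have "(\<Sum>w\<in>words V t. of_bool (code (Some a) w)) = (real n ^ t - (-1) ^ t) / (real n + 1)"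
      using code_size(1)[OF fin a, of t] assms(3) by (simp add: field_simps)
    then show ?thesis by simp
  qed
  also have "\<dots> = (if even t then (2 * real n ^ t + real n - 1) / (real n + 1)
             else 2 * (real n ^ t + 1) / (real n + 1))"
    using of_nat_0_le_iff[of n, where ?'a = real] by (cases "even t") (auto simp: divide_simps)
  finally show ?thesis .
qed

end
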